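(* Let $Q\subset\mathbb{R}^n$ be a compact convex set of diameter $D$ with respect to a norm $\|\cdot\|$, let $c>0$, and let $f:Q\to\mathbb{R}$ be a differentiable convex $c$-gradient dominated function. Suppose there is a minimizer $x^*$ of $f$ on $Q$ lying in the interior of $Q$, i.e. there is a radius $r>0$ such that $B(x^*,r)\subset Q$, and let $f^*=f(x^* )$. Let $x_0,\dots,x_N$ be the points, $L_0,\dots,L_{N-1}$ the accepted parameters and $\alpha_0,\dots,\alpha_{N-1}$ the step sizes produced by the adaptive Frank–Wolfe algorithm (described in the context). Then for every $1\le k\le N$ $$f(x_k)-f^*\le (f(x_0)-f^* )\prod_{i=0}^{k-1}\varphi_i,$$ where $$\varphi_i=\begin{cases}\dfrac12,&\text{if }\alpha_i=1,\\[2mm] 1-\dfrac{r^2}{2L_ic^2D^2},&\text{if }\alpha_i<1.\end{cases}$$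
   Context: The problem is $\min_{x\in Q}f(x)$. $\|\cdot\|_*$ denotes the norm dual to $\|\cdot\|$; $B(x^*,r)$ is the ball of radius $r$ centred at $x^*$ in the norm $\|\cdot\|$; $D=\max_{x,y\in Q}\|x-y\|$. A differentiable function $f$ is called $c$-gradient dominated, for a constant $c>0$, if for all $x,y$ in its domain $$\frac{f(x)-f(y)}{c^2}\le\|\nabla f(x)\|_*^2.$$ Adaptive Frank–Wolfe algorithm. Input: number of iterations $N$, starting point $x_0\in Q$, and $L_{-1}>0$. For $k=0,1,\dots,N-1$: 1. Set $L_k:=L_{k-1}/2$ and choose $s_k\in\arg\min_{x\in Q}\nabla f(x_k)^\top x$. 2. Set $d_k:=s_k-x_k$ and $\theta_k:=\min\left\{-\frac{\nabla f(x_k)^\top d_k}{L_k\|d_k\|^2},\,1\right\}$. 3. If $\theta_k<1$: if $f(x_k+\theta_kd_k)\le f(x_k)-\frac{(\nabla f(x_k)^\top d_k)^2}{2L_k\|d_k\|^2}$, accept $\alpha_k:=\theta_k$, set $x_{k+1}:=x_k+\alpha_kd_k$ and finish iteration $k$; otherwise replace $L_k$ by $2L_k$ and return to step 2. 4. If $\theta_k=1$: if $f(x_k+d_k)\le f(x_k)+\nabla f(x_k)^\top d_k+\frac{L_k}{2}\|d_k\|^2$, accept $\alpha_k:=1$, set $x_{k+1}:=x_k+d_k$ and finish iteration $k$; otherwise replace $L_k$ by $2L_k$ and return to step 2. Below and in the claim, $L_k$ denotes the final value with which iteration $k$ finished. It is assumed that each of the $N$ iterations finishes (its exit criterion is met after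 finitely many doublings) and that $d_k\neq0$ at each performed iteration, so that $\theta_k$ is defined.
   Formalization: The bound is proved for those k with f(x_{k-1}) ≠ f*; if f(x_{k-1}) = f*, it is proved instead that f(x_k) = f*, since there L_i may keep halving and the product of the φ_i may become negative, so that the stated bound can fail. *)

theory Defs
  imports "HOL-Analysis.Analysis"
begin

definition is_norm :: "(real^'n \<Rightarrow> real) \<Rightarrow> bool" where
  "is_norm nrm \<longleftrightarrow>
     (\<forall>x. 0 \<le> nrm x) \<and> (\<forall>x. nrm x = 0 \<longleftrightarrow> x = 0) \<and>
     (\<forall>a x. nrm (a *\<^sub>R x) = \<bar>a\<bar> * nrm x) \<and> (\<forall>x y. nrm (x + y) \<le> nrm x + nrm y)"

definition dual_norm :: "(real^'n \<Rightarrow> real) \<Rightarrow> real^'n \<Rightarrow> real" where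
  "dual_norm nrm v = (SUP u\<in>{u. nrm u \<le> 1}. v \<bullet> u)"

definition norm_ball :: "(real^'n \<Rightarrow> real) \<Rightarrow> real^'n \<Rightarrow> real \<Rightarrow> (real^'n) set" where
  "norm_ball nrm x r = {y. nrm (y - x) < r}"

definition norm_diameter :: "(real^'n \<Rightarrow> real) \<Rightarrow> (real^'n) set \<Rightarrow> real" where
  "norm_diameter nrm Q = (SUP (x, y)\<in>Q \<times> Q. nrm (x - y))"

text \<open>The function is only given on \<open>Q\<close>, so the gradient is taken relative to \<open>Q\<close>. When
  \<open>Q\<close> is convex with nonempty interior this relative derivative is unique, also at boundary points.\<close>

definition gradient_on :: "(real^'n) set \<Rightarrow> (real^'n \<Rightarrow> real) \<Rightarrow> real^'n \<Rightarrow> real^'n" where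
  "gradient_on Q f x = (\<chi> i. frechet_derivative f (at x within Q) (axis i 1))"

definition gradient_dominated ::
  "(real^'n \<Rightarrow> real) \<Rightarrow> (real^'n) set \<Rightarrow> real \<Rightarrow> (real^'n \<Rightarrow> real) \<Rightarrow> bool" where
  "gradient_dominated nrm Q c f \<longleftrightarrow>
     (\<forall>x\<in>Q. \<forall>y\<in>Q. (f x - f y) / c\<^sup>2 \<le> (dual_norm nrm (gradient_on Q f x))\<^sup>2)"

text \<open>In the next two definitions \<open>g\<close> is the gradient at the current point \<open>x\<close>,
  \<open>d\<close> the direction and \<open>l\<close> the trial value of the parameter \<open>L\<^sub>k\<close>.\<close>

definition fw_theta :: "(real^'n \<Rightarrow> real) \<Rightarrow> real^'n \<Rightarrow> real^'n \<Rightarrow> real \<Rightarrow> real" where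
  "fw_theta nrm g d l = min (- (g \<bullet> d) / (l * (nrm d)\<^sup>2)) 1"

definition fw_accept ::
  "(real^'n \<Rightarrow> real) \<Rightarrow> (real^'n \<Rightarrow> real) \<Rightarrow> real^'n \<Rightarrow> real^'n \<Rightarrow> real^'n \<Rightarrow> real \<Rightarrow> bool" where
  "fw_accept nrm f x g d l \<longleftrightarrow>
     (if fw_theta nrm g d l < 1
      then f (x + fw_theta nrm g d l *\<^sub>R d) \<le> f x - (g \<bullet> d)\<^sup>2 / (2 * l * (nrm d)\<^sup>2)
      else f (x + d) \<le> f x + g \<bullet> d + l / 2 * (nrm d)\<^sup>2)"

text \<open>\<open>doubling acc l l'\<close>: the loop that starts with \<open>l\<close> and doubles as long as
  the test \<open>acc\<close> fails terminates with the value \<open>l'\<close>.\<close>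

inductive doubling :: "(real \<Rightarrow> bool) \<Rightarrow> real \<Rightarrow> real \<Rightarrow> bool" for acc :: "real \<Rightarrow> bool" where
  accept: "acc l \<Longrightarrow> doubling acc l l"
| reject: "\<not> acc l \<Longrightarrow> doubling acc (2 * l) l' \<Longrightarrow> doubling acc l l'"

definition fw_iteration ::
  "(real^'n \<Rightarrow> real) \<Rightarrow> (real^'n) set \<Rightarrow> (real^'n \<Rightarrow> real) \<Rightarrow> real^'n \<Rightarrow> real \<Rightarrow>
   real^'n \<Rightarrow> real \<Rightarrow> real \<Rightarrow> real^'n \<Rightarrow> bool" where
  "fw_iteration nrm Q f x Lprev s L \<alpha> x' \<longleftrightarrow>
     (let g = gradient_on Q f x; d = s - x in
        is_arg_min (\<lambda>y. g \<bullet> y) (\<lambda>y. y \<in> Q) s \<and>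
        d \<noteq> 0 \<and>
        doubling (fw_accept nrm f x g d) (Lprev / 2) L \<and>
        \<alpha> = fw_theta nrm g d L \<and>
        x' = x + \<alpha> *\<^sub>R d)"

text \<open>\<open>Linit\<close> is \<open>L\<^sub>-\<^sub>1\<close>.\<close>

definition adaptive_fw_run ::
  "(real^'n \<Rightarrow> real) \<Rightarrow> (real^'n) set \<Rightarrow> (real^'n \<Rightarrow> real) \<Rightarrow> nat \<Rightarrow> real \<Rightarrow>
   (nat \<Rightarrow> real^'n) \<Rightarrow> (nat \<Rightarrow> real^'n) \<Rightarrow> (nat \<Rightarrow> real) \<Rightarrow> (nat \<Rightarrow> real) \<Rightarrow> bool" where
  "adaptive_fw_run nrm Q f N Linit x s L \<alpha> \<longleftrightarrow>
     0 < Linit \<and> x 0 \<in> Q \<and>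
     (\<forall>k<N. fw_iteration nrm Q f (x k) (if k = 0 then Linit else L (k - 1))
              (s k) (L k) (\<alpha> k) (x (Suc k)))"

text \<open>The factor can be negative: once an iterate is optimal, every later iteration accepts
  \<open>\<alpha> = 0\<close> at its first trial value and so halves \<open>L\<close>. A product of factors is therefore a
  meaningful bound only up to the first optimal iterate.\<close>

definition fw_factor :: "real \<Rightarrow> real \<Rightarrow> real \<Rightarrow> real \<Rightarrow> real \<Rightarrow> real" where
  "fw_factor c r D L \<alpha> = (if \<alpha> = 1 then 1 / 2 else 1 - r\<^sup>2 / (2 * L * c\<^sup>2 * D\<^sup>2))"

end

theory Submission
  imports Defs
begin

text \<open>Write \<open>h\<close> for the gap \<open>f x - f xstar\<close>, \<open>g\<close> for the gradient at \<open>x\<close> and \<open>d = s - x\<close>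
  for the Frank--Wolfe direction. The theorem rests on a contraction of the gap by
  \<open>fw_factor\<close> in each single iteration (\<open>fw_iteration_gap\<close>), which compares two lower bounds
  for the Frank--Wolfe gap \<open>- (g \<bullet> d)\<close>.

  Since \<open>s\<close> minimises the linear form \<open>g\<close> over \<open>Q\<close>, comparing with \<open>xstar\<close> and using convexity
  gives \<open>h \<le> - (g \<bullet> d)\<close> (\<open>fw_gap_ge\<close>). A full step means \<open>l * (nrm d)\<^sup>2 \<le> - (g \<bullet> d)\<close>, so that
  the accepted quadratic upper bound decreases \<open>f\<close> by at least half of \<open>- (g \<bullet> d)\<close>, hence by
  \<open>h / 2\<close>.

  Comparing instead with the points of the ball around \<open>xstar\<close> gives
  \<open>r * dual_norm nrm g \<le> - (g \<bullet> d)\<close> (\<open>fw_gap_ge_dual_norm\<close>): the linear form can be lowered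
  from \<open>xstar\<close> by almost \<open>r\<close> times its dual norm without leaving \<open>Q\<close>. A shorter step
  decreases \<open>f\<close> by at least \<open>(g \<bullet> d)\<^sup>2 / (2 * l * (nrm d)\<^sup>2)\<close>, and gradient domination bounds the
  squared dual norm below by \<open>h / c\<^sup>2\<close>, while \<open>nrm d\<close> is at most the diameter.

  The contractions multiply as long as the gap is positive: the factor of an iteration that
  starts with a positive gap is nonnegative because the next gap is nonnegative. A gap that is zero
  stays zero, which is the second half of the claim.\<close>

section \<open>Convexity and norms\<close>

text \<open>Difference quotients along a segment are at most the slope of the chord, and the
  derivative is their one-sided limit. Only one-sided limits are available because \<open>x\<close> may lie on
  the boundary of \<open>Q\<close>.\<close>

lemma convex_on_has_derivative_le:
  fixes f :: "'a::real_normed_vector \<Rightarrow> real"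
  assumes conv: "convex_on Q f"
    and der: "(f has_derivative f') (at x within Q)"
    and x: "x \<in> Q" and y: "y \<in> Q"
  shows "f' (y - x) \<le> f y - f x"
proof -
  have Q: "convex Q" using conv by (rule convex_on_imp_convex)
  let ?p = "\<lambda>t::real. x + t *\<^sub>R (y - x)"
  have p_eq: "?p t = (1 - t) *\<^sub>R x + t *\<^sub>R y" for t by (simp add: algebra_simps)
  have p_in: "?p ` {0..1} \<subseteq> Q"
    unfolding p_eq using Q x y by (auto intro!: convexD_alt)
  have lin: "f' (t *\<^sub>R v) = t * f' v" for t v
    using has_derivative_linear[OF der] by (simp add: linear_cmul)
  have "(f has_derivative f') (at (?p 0) within ?p ` {0..1})"
    using has_derivative_subset[OF der p_in] by simp
  moreover have "(?p has_derivative (\<lambda>t. t *\<^sub>R (y - x))) (at 0 within {0..1})"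
    by (auto intro!: derivative_eq_intros)
  ultimately have "((\<lambda>t. f (?p t)) has_derivative (\<lambda>t. f' (t *\<^sub>R (y - x)))) (at 0 within {0..1})"
    by (rule has_derivative_in_compose[rotated])
  hence "((\<lambda>t. f (?p t)) has_real_derivative f' (y - x)) (at 0 within {0..1})"
    by (simp only: lin has_field_derivative_def mult.commute[of _ "f' (y - x)"])
  hence lim: "((\<lambda>t. (f (?p t) - f x) / t) \<longlongrightarrow> f' (y - x)) (at 0 within {0..1})"
    by (simp add: has_field_derivative_iff)
  have chord: "(f (?p t) - f x) / t \<le> f y - f x" if t: "t \<in> {0..1}" "t \<noteq> 0" for t
  proof -
    have "f (?p t) \<le> (1 - t) * f x + t * f y"
      unfolding p_eq using convex_onD[OF conv, of t x y] t x y by simp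
    thus ?thesis using t by (simp add: field_simps)
  qed
  have "at (0::real) within {0..1} \<noteq> bot"
    by (simp add: trivial_limit_within islimpt_Icc)
  from tendsto_upperbound[OF lim _ this] show ?thesis
    by (auto simp: eventually_at_filter chord)
qed

text \<open>Coordinatewise reconstruction of the derivative: the vector \<open>gradient_on\<close> represents
  whatever derivative the choice operator picks, even where it is not unique.\<close>

lemma gradient_on_inner:
  fixes f :: "real^'n \<Rightarrow> real"
  assumes "f differentiable_on Q" and "x \<in> Q"
  shows "gradient_on Q f x \<bullet> v = frechet_derivative f (at x within Q) v"
proof -
  let ?F = "frechet_derivative f (at x within Q)"
  have "f differentiable (at x within Q)"
    using assms by (simp add: differentiable_on_def)
  hence lin: "linear ?F" by (rule linear_frechet_derivative)
  have "?F v = ?F (\<Sum>i\<in>UNIV. v $ i *\<^sub>R axis i 1)"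
    using basis_expansion[of v] by (simp add: scalar_mult_eq_scaleR)
  also have "\<dots> = (\<Sum>i\<in>UNIV. v $ i * ?F (axis i 1))"
    using lin by (simp add: linear_sum linear_cmul)
  also have "\<dots> = gradient_on Q f x \<bullet> v"
    by (simp add: gradient_on_def inner_vec_def mult.commute)
  finally show ?thesis by simp
qed

lemma gradient_on_le:
  fixes f :: "real^'n \<Rightarrow> real"
  assumes "f differentiable_on Q" "convex_on Q f" "x \<in> Q" "y \<in> Q"
  shows "gradient_on Q f x \<bullet> (y - x) \<le> f y - f x"
proof -
  have "f differentiable (at x within Q)"
    using assms by (simp add: differentiable_on_def)
  hence "(f has_derivative frechet_derivative f (at x within Q)) (at x within Q)"
    by (simp add: frechet_derivative_works)
  from convex_on_has_derivative_le[OF assms(2) this assms(3,4)] show ?thesis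
    using gradient_on_inner[OF assms(1,3)] by simp
qed

lemma is_norm_le_norm:
  fixes nrm :: "real^'n \<Rightarrow> real"
  assumes "is_norm nrm"
  shows "nrm v \<le> (\<Sum>i\<in>UNIV. nrm (axis i 1)) * norm v"
proof -
  have zero: "nrm 0 = 0" and scale: "nrm (a *\<^sub>R w) = \<bar>a\<bar> * nrm w"
    and tri: "nrm (w + z) \<le> nrm w + nrm z" and pos: "0 \<le> nrm w" for a w z
    using assms by (auto simp: is_norm_def)
  have sum_le: "nrm (\<Sum>i\<in>A. w i) \<le> (\<Sum>i\<in>A. nrm (w i))" if "finite A" for A and w :: "'n \<Rightarrow> real^'n"
    using that
  proof (induction A)
    case (insert a A)
    then show ?case using tri[of "w a" "sum w A"] by simp
  qed (simp add: zero)
  have "nrm v = nrm (\<Sum>i\<in>UNIV. v $ i *\<^sub>R axis i 1)"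
    using basis_expansion[of v] by (simp add: scalar_mult_eq_scaleR)
  also have "\<dots> \<le> (\<Sum>i\<in>UNIV. nrm (v $ i *\<^sub>R axis i 1))"
    by (rule sum_le) simp
  also have "\<dots> \<le> (\<Sum>i\<in>UNIV. nrm (axis i 1) * norm v)"
    by (intro sum_mono)
      (metis scale mult.commute mult_right_mono component_le_norm_cart pos)
  finally show ?thesis by (simp add: sum_distrib_right)
qed

text \<open>Boundedness in the Euclidean norm carries over to \<open>nrm\<close>; without it the
  supremum that defines the diameter would be unspecified.\<close>

lemma nrm_diff_le_norm_diameter:
  fixes nrm :: "real^'n \<Rightarrow> real"
  assumes nrm: "is_norm nrm" and Q: "bounded Q" and "x \<in> Q" and "y \<in> Q"
  shows "nrm (x - y) \<le> norm_diameter nrm Q"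
proof -
  let ?C = "\<Sum>i\<in>UNIV. nrm (axis i 1)"
  have C: "0 \<le> ?C" using nrm by (auto simp: is_norm_def intro: sum_nonneg)
  obtain B where B: "\<And>z. z \<in> Q \<Longrightarrow> norm z \<le> B"
    using Q by (auto simp: bounded_iff)
  have "nrm (a - b) \<le> ?C * (B + B)" if "a \<in> Q" "b \<in> Q" for a b
  proof -
    have "norm (a - b) \<le> B + B"
      using norm_triangle_ineq4[of a b] B that by (meson add_mono order_trans)
    thus ?thesis using is_norm_le_norm[OF nrm, of "a - b"] mult_left_mono[OF _ C] by fastforce
  qed
  hence "bdd_above ((\<lambda>(a, b). nrm (a - b)) ` (Q \<times> Q))"
    by (intro bdd_aboveI[of _ "?C * (B + B)"]) auto
  from cSUP_upper[OF _ this, of "(x, y)"] show ?thesis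
    using assms by (simp add: norm_diameter_def)
qed

section \<open>Lower bounds for the Frank--Wolfe gap\<close>

lemma fw_gap_ge:
  fixes f :: "real^'n \<Rightarrow> real"
  assumes "f differentiable_on Q" "convex_on Q f" "x \<in> Q" "y \<in> Q"
    and s: "is_arg_min (\<lambda>z. gradient_on Q f x \<bullet> z) (\<lambda>z. z \<in> Q) s"
  shows "f x - f y \<le> - (gradient_on Q f x \<bullet> (s - x))"
proof -
  have "gradient_on Q f x \<bullet> s \<le> gradient_on Q f x \<bullet> y"
    using s \<open>y \<in> Q\<close> by (simp add: is_arg_min_linorder)
  thus ?thesis using gradient_on_le[OF assms(1-4)] by (simp add: inner_diff_right)
qed

text \<open>For \<open>nrm u \<le> 1\<close> and \<open>0 \<le> t < r\<close> the point \<open>z - t *\<^sub>R u\<close> lies in the ball, hence in \<open>Q\<close>,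
  and the linear form is lower there than at \<open>z\<close> by \<open>t * (g \<bullet> u)\<close>. The open ball forces the limit
  \<open>t \<rightarrow> r\<close>. The hypothesis \<open>g \<bullet> z \<le> g \<bullet> x\<close> says that passing from \<open>x\<close> to the centre loses nothing.\<close>

lemma fw_gap_ge_dual_norm:
  fixes nrm :: "real^'n \<Rightarrow> real"
  assumes nrm: "is_norm nrm" and r: "0 < r" and ball: "norm_ball nrm z r \<subseteq> Q"
    and s: "is_arg_min (\<lambda>y. g \<bullet> y) (\<lambda>y. y \<in> Q) s" and z: "g \<bullet> z \<le> g \<bullet> x"
  shows "0 \<le> dual_norm nrm g" and "r * dual_norm nrm g \<le> - (g \<bullet> (s - x))"
proof -
  let ?G = "- (g \<bullet> (s - x))"
  have scale: "nrm (a *\<^sub>R v) = \<bar>a\<bar> * nrm v" and pos: "0 \<le> nrm v" and nrm0: "nrm 0 = 0" for a v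
    using nrm by (auto simp: is_norm_def)
  have le: "g \<bullet> u \<le> ?G / r" if u: "nrm u \<le> 1" for u
  proof -
    have G: "t * (g \<bullet> u) \<le> ?G" if t: "0 \<le> t" "t < r" for t
    proof -
      have "nrm ((- t) *\<^sub>R u) < r"
        using mult_left_mono[OF u t(1)] t by (simp only: scale) simp
      hence "z - t *\<^sub>R u \<in> Q"
        using ball by (auto simp: norm_ball_def)
      hence "g \<bullet> s \<le> g \<bullet> (z - t *\<^sub>R u)"
        using s by (simp add: is_arg_min_linorder)
      thus ?thesis using z by (simp add: inner_diff_right)
    qed
    have "r * (g \<bullet> u) \<le> ?G"
    proof (rule tendsto_upperbound)
      show "((\<lambda>t. t * (g \<bullet> u)) \<longlongrightarrow> r * (g \<bullet> u)) (at_left r)"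
        by (intro tendsto_intros)
      show "\<forall>\<^sub>F t in at_left r. t * (g \<bullet> u) \<le> ?G"
        using eventually_at_left_real[OF r] by eventually_elim (auto intro: G)
    qed simp
    thus ?thesis using r by (simp add: field_simps)
  qed
  hence bdd: "bdd_above ((\<lambda>u. g \<bullet> u) ` {u. nrm u \<le> 1})"
    by (intro bdd_aboveI[of _ "?G / r"]) auto
  show "0 \<le> dual_norm nrm g"
    using cSUP_upper[OF _ bdd, of 0] by (simp add: dual_norm_def nrm0)
  have "0 \<in> {u. nrm u \<le> 1}" by (simp add: nrm0)
  hence "dual_norm nrm g \<le> ?G / r"
    unfolding dual_norm_def by (intro cSUP_least) (auto simp only: le mem_Collect_eq)
  thus "r * dual_norm nrm g \<le> ?G" using r by (simp add: field_simps)
qed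

section \<open>One iteration\<close>

lemma doubling_accepts:
  assumes "doubling acc l l'" and "0 < l"
  shows "acc l' \<and> 0 < l'"
  using assms by induction auto

text \<open>The two cases of the accepted step length correspond to the two lower bounds for
  \<open>- (g \<bullet> d)\<close>. The contraction holds for a zero gap as well, whatever the sign of the
  factor, so that optimality of an iterate is inherited by the next one.\<close>

lemma fw_iteration_gap:
  fixes nrm :: "real^'n \<Rightarrow> real"
  assumes nrm: "is_norm nrm" and Q: "compact Q" "convex Q" and c: "0 < c"
    and f: "f differentiable_on Q" "convex_on Q f" and dom: "gradient_dominated nrm Q c f"
    and xstar: "is_arg_min f (\<lambda>y. y \<in> Q) xstar"
    and r: "0 < r" and ball: "norm_ball nrm xstar r \<subseteq> Q"
    and x: "x \<in> Q" and Lprev: "0 < Lprev"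
    and iter: "fw_iteration nrm Q f x Lprev s l \<alpha> x'"
  shows "0 < l" and "x' \<in> Q"
    and "f x' - f xstar \<le> (f x - f xstar) * fw_factor c r (norm_diameter nrm Q) l \<alpha>"
proof -
  define g d D where "g = gradient_on Q f x" and "d = s - x" and "D = norm_diameter nrm Q"
  note [simp] = g_def[symmetric] D_def[symmetric]
    and fold_d [simp] = d_def[symmetric]
  let ?h = "f x - f xstar"
  have s: "is_arg_min (\<lambda>y. g \<bullet> y) (\<lambda>y. y \<in> Q) s" and d0: "d \<noteq> 0"
    and doub: "doubling (fw_accept nrm f x g d) (Lprev / 2) l"
    and \<alpha>: "\<alpha> = fw_theta nrm g d l" and x': "x' = x + \<alpha> *\<^sub>R d"
    using iter by (simp_all add: fw_iteration_def Let_def)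
  have acc: "fw_accept nrm f x g d l" and l: "0 < l"
    using doubling_accepts[OF doub] Lprev by simp_all
  show "0 < l" by (rule l)
  have xs: "xstar \<in> Q" and opt: "\<And>y. y \<in> Q \<Longrightarrow> f xstar \<le> f y"
    using xstar by (auto simp: is_arg_min_linorder)
  have sQ: "s \<in> Q" using s by (simp add: is_arg_min_linorder)
  have h: "0 \<le> ?h" using opt[OF x] by simp
  have gap: "?h \<le> - (g \<bullet> d)"
    using fw_gap_ge[OF f x xs, of s] s by simp
  have nd: "0 < nrm d" using nrm d0 unfolding is_norm_def by (metis less_eq_real_def)
  hence ld: "0 < l * (nrm d)\<^sup>2" using l by simp
  have "nrm d \<le> D"
    using nrm_diff_le_norm_diameter[OF nrm compact_imp_bounded[OF Q(1)] sQ x] by simp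
  with nd have D2: "(nrm d)\<^sup>2 \<le> D\<^sup>2" and D: "0 < D" by (auto intro: power_mono)
  have \<alpha>01: "0 \<le> \<alpha>" "\<alpha> \<le> 1"
    using gap h ld by (auto simp: \<alpha> fw_theta_def intro!: divide_nonpos_pos)
  have "x' = (1 - \<alpha>) *\<^sub>R x + \<alpha> *\<^sub>R s"
    unfolding x' d_def by (simp add: algebra_simps del: fold_d)
  thus "x' \<in> Q" using Q(2) x sQ \<alpha>01 by (simp add: convexD_alt)
  have "f x' - f xstar \<le> ?h * fw_factor c r D l \<alpha>"
  proof (cases "\<alpha> = 1")
    case True
    hence "f x' \<le> f x + g \<bullet> d + l / 2 * (nrm d)\<^sup>2"
      using acc by (simp add: fw_accept_def \<alpha>[symmetric] x')
    moreover have "1 \<le> - (g \<bullet> d) / (l * (nrm d)\<^sup>2)"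
      using True by (simp add: \<alpha> fw_theta_def min_def split: if_splits)
    with ld have "l * (nrm d)\<^sup>2 \<le> - (g \<bullet> d)"
      by (simp only: pos_le_divide_eq mult_1)
    ultimately have "f x' - f xstar \<le> ?h / 2" using gap by simp
    thus ?thesis using True by (simp add: fw_factor_def)
  next
    case False
    with \<alpha>01 have "\<alpha> < 1" by simp
    hence dec: "f x' \<le> f x - (g \<bullet> d)\<^sup>2 / (2 * l * (nrm d)\<^sup>2)"
      using acc by (simp add: fw_accept_def \<alpha>[symmetric] x')
    have "g \<bullet> xstar \<le> g \<bullet> x"
      using gradient_on_le[OF f x xs] h by (simp add: inner_diff_right)
    note dual = fw_gap_ge_dual_norm[OF nrm r ball s this]
    have "?h / c\<^sup>2 \<le> (dual_norm nrm g)\<^sup>2"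
      using dom x xs by (auto simp: gradient_dominated_def)
    hence "r\<^sup>2 * (?h / c\<^sup>2) \<le> r\<^sup>2 * (dual_norm nrm g)\<^sup>2"
      by (rule mult_left_mono) simp
    also have "\<dots> = (r * dual_norm nrm g)\<^sup>2" by (simp add: power_mult_distrib)
    also have "\<dots> \<le> (- (g \<bullet> d))\<^sup>2"
      using dual r by (intro power_mono) simp_all
    finally have "r\<^sup>2 * (?h / c\<^sup>2) \<le> (g \<bullet> d)\<^sup>2" by simp
    hence "r\<^sup>2 * (?h / c\<^sup>2) / (2 * l * D\<^sup>2) \<le> (g \<bullet> d)\<^sup>2 / (2 * l * (nrm d)\<^sup>2)"
      using D2 l nd by (intro frac_le) simp_all
    with dec have "f x' - f xstar \<le> ?h - r\<^sup>2 * (?h / c\<^sup>2) / (2 * l * D\<^sup>2)" by simp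
    also have "\<dots> = ?h * fw_factor c r D l \<alpha>"
      using False c l D by (simp add: fw_factor_def field_simps)
    finally show ?thesis .
  qed
  thus "f x' - f xstar \<le> ?h * fw_factor c r (norm_diameter nrm Q) l \<alpha>" by simp
qed

section \<open>Linear convergence\<close>

text \<open>A factor may be negative only when the gap before it is zero: otherwise the next gap could
  not be nonnegative. This makes the factors multiply along the positive gaps.\<close>

lemma gap_le_prod:
  fixes h p :: "nat \<Rightarrow> real"
  assumes nonneg: "\<And>k. k \<le> N \<Longrightarrow> 0 \<le> h k"
    and step: "\<And>k. k < N \<Longrightarrow> h (Suc k) \<le> h k * p k"
  shows "k < N \<Longrightarrow> h k \<noteq> 0 \<Longrightarrow> h (Suc k) \<le> h 0 * (\<Prod>i=0..k. p i)"
proof (induction k)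
  case 0
  then show ?case using step[of 0] by simp
next
  case (Suc k)
  have "h k \<noteq> 0"
    using step[of k] nonneg[of "Suc k"] Suc.prems by auto
  hence IH: "h (Suc k) \<le> h 0 * (\<Prod>i=0..k. p i)"
    using Suc by simp
  have "0 < h (Suc k)"
    using nonneg[of "Suc k"] Suc.prems by simp
  moreover have "0 \<le> h (Suc k) * p (Suc k)"
    using step[of "Suc k"] nonneg[of "Suc (Suc k)"] Suc.prems by simp
  ultimately have "0 \<le> p (Suc k)" by (simp add: zero_le_mult_iff)
  with IH have "h (Suc k) * p (Suc k) \<le> h 0 * (\<Prod>i=0..k. p i) * p (Suc k)"
    by (rule mult_right_mono)
  thus ?case using step[of "Suc k"] Suc.prems by (simp add: mult.assoc)
qed

theorem mainTheorem2:
  fixes nrm :: "real^'n \<Rightarrow> real" and Q :: "(real^'n) set" and f :: "real^'n \<Rightarrow> real"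
    and c r D Linit :: real and N :: nat and xstar :: "real^'n"
    and x s :: "nat \<Rightarrow> real^'n" and L \<alpha> :: "nat \<Rightarrow> real"
  assumes "is_norm nrm"
    and "compact Q" and "convex Q" and "D = norm_diameter nrm Q"
    and "0 < c" and "f differentiable_on Q" and "convex_on Q f"
    and "gradient_dominated nrm Q c f"
    and "is_arg_min f (\<lambda>y. y \<in> Q) xstar"
    and "0 < r" and "norm_ball nrm xstar r \<subseteq> Q"
    and "adaptive_fw_run nrm Q f N Linit x s L \<alpha>"
  shows "\<forall>k. 1 \<le> k \<and> k \<le> N \<longrightarrow>
           (f (x (k - 1)) \<noteq> f xstar \<longrightarrow>
              f (x k) - f xstar
                \<le> (f (x 0) - f xstar) * (\<Prod>i=0..k-1. fw_factor c r D (L i) (\<alpha> i))) \<and>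
           (f (x (k - 1)) = f xstar \<longrightarrow> f (x k) = f xstar)"
proof -
  let ?h = "\<lambda>k. f (x k) - f xstar"
  let ?p = "\<lambda>k. fw_factor c r D (L k) (\<alpha> k)"
  have run: "0 < Linit" "x 0 \<in> Q"
    and iter: "\<And>k. k < N \<Longrightarrow> fw_iteration nrm Q f (x k) (if k = 0 then Linit else L (k - 1))
                  (s k) (L k) (\<alpha> k) (x (Suc k))"
    using assms(12) by (auto simp: adaptive_fw_run_def)
  note iteration = fw_iteration_gap[OF assms(1-3,5-11)]
  \<comment> \<open>The index is shifted by one, as \<open>Linit\<close> stands in front of \<open>L 0\<close>.\<close>
  have inv: "x k \<in> Q \<and> 0 < (if k = 0 then Linit else L (k - 1))" if "k \<le> N" for k
    using that
  proof (induction k)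
    case (Suc k)
    then show ?case using iteration(1,2)[OF _ _ iter[of k]] by simp
  qed (simp add: run)
  have step: "?h (Suc k) \<le> ?h k * ?p k" if "k < N" for k
    using iteration(3)[OF _ _ iter[OF that]] inv[of k] that assms(4) by simp
  have nonneg: "0 \<le> ?h k" if "k \<le> N" for k
    using inv[OF that] assms(9) by (simp add: is_arg_min_linorder)
  show ?thesis
  proof (intro allI impI)
    fix k assume "1 \<le> k \<and> k \<le> N"
    then obtain j where k: "k = Suc j" and j: "j < N" by (cases k) auto
    have "?h (Suc j) \<le> ?h 0 * (\<Prod>i=0..j. ?p i)" if "f (x j) \<noteq> f xstar"
      using gap_le_prod[of N ?h ?p j, OF nonneg step j] that by simp
    moreover have "f (x (Suc j)) = f xstar" if "f (x j) = f xstar"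
      using step[OF j] nonneg[of "Suc j"] j that by simp
    ultimately show
      "(f (x (k - 1)) \<noteq> f xstar \<longrightarrow>
          f (x k) - f xstar \<le> (f (x 0) - f xstar) * (\<Prod>i=0..k-1. ?p i)) \<and>
       (f (x (k - 1)) = f xstar \<longrightarrow> f (x k) = f xstar)"
      by (simp add: k)
  qed
qed

end
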